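(* Let $m,n$ be nonnegative integers, let $I\subseteq[m-1]$, $J\subseteq[n-1]$, and let $\nu>1$ be an integer. Then $$\mathbf m(\kappa_I(\nu),\kappa_J(\nu))=\sum_{K\subseteq[m+n-1]}d_K\,\kappa_K(\nu),\qquad d_K=\sum_{A}\left(\frac1{1-\nu}\right)^{|K\cap\mathsf e(A^{\mathrm c})|},$$ where the sum defining $d_K$ is over all $n$-element subsets $A\subseteq[m+n]$ such that $(I\#_AJ)\cap\overline{\mathsf e}(A)=\emptyset$ and $I\#_AJ\subseteq K\subseteq(I\#_AJ)\cup\overline{\mathsf e}(A)$.
   Context: Notation: $[k]=\{1,\dots,k\}$ for $k\ge1$ and $[k]=\emptyset$ for $k\le 0$. Let $C_\nu$ be a cyclic group of order $\nu$, written additively. For $n\ge0$ let $Q_n(\nu)=\bigoplus_{i\in[n-1]}C_\nu$ (trivial if $n\le1$), with elements $g=(g_i)_{i\in[n-1]}$; $\mathrm{cf}(Q_n(\nu))$ is the space of complex (class) functions on $Q_n(\nu)$, with $\mathrm{cf}(Q_0(\nu))=\mathbb C\mathbb 1_0$. For $I\subseteq[n-1]$, the superclass identifier $\kappa_I(\nu)$ is the indicator function of the superclass $\mathrm{cl}_I(\nu)=\{g\in Q_n(\nu): g_i\neq0\iff i\in I\}$; $\mathrm{scf}(\mathcal N_n(\nu))$ is the span of the $\kappa_I(\nu)$, $I\subseteq[n-1]$. Let $\bar r$ be the function on $C_\nu$ with $\bar r(0)=1$, $\bar r(g)=-1/(\nu-1)$ for $g\ne0$. For $A\subseteq[N]$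 put $A^{\mathrm c}=[N]\setminus A$, $\mathsf e(A)=\{i\in[N-1]: i\in A, i+1\notin A\}$ (right endpoints, other than $N$, of the maximal intervals of $A$), $\overline{\mathsf e}(A)=\mathsf e(A)\sqcup\mathsf e(A^{\mathrm c})$. For an $n$-element subset $A=\{a_1<\dots<a_n\}\subseteq[m+n]$ with $A^{\mathrm c}=\{b_1<\dots<b_m\}$, and $I\subseteq[m-1]$, $J\subseteq[n-1]$, put $I\#_AJ=\{b_i:i\in I\}\sqcup\{a_j:j\in J\}\subseteq[m+n-1]$. Product $\mathbf m$. Let $\phi\in\mathrm{cf}(Q_m(\nu))$, $\psi\in\mathrm{cf}(Q_n(\nu))$. If $m=0$ or $n=0$, $\mathbf m_A(\phi,\psi)$ is the scalar product (identifying $\mathbb C\mathbb 1_0$ with $\mathbb C$). Otherwise for $h\in\bigoplus_{i\in[m+n]}C_\nu$ put $$\mathbf s_A(\phi,\psi)(h)=\phi(h_{b_1},\dots,h_{b_{m-1}})\,\bar r(h_{b_m})\,\psi(h_{a_1},\dots,h_{a_{n-1}})\,\bar r(h_{a_n}),$$ and for $g\in Q_{m+n}(\nu)$ define $$\mathbf m_A(\phi,\psi)(g)=\Big(\prod_{i\in\mathsf e(A^{\mathrm c})}\bar r(g_i)\Big)\,\mathbf s_A(\phi,\psi)(g^A),$$ where $g^A_i=g_i$ for $i\in[m+n-1]\setminus\overline{\mathsf e}(A)$ and $g^A_i=0$ for all other $i\in[m+n]$. Then $\mathbf m(\phi,\psi)=\sum_{A\subseteq[m+n],|A|=n}\mathbf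 m_A(\phi,\psi)$. *)

theory Defs
  imports Complex_Main "HOL-Library.Indicator_Function" "HOL-Algebra.Algebra"
begin

text \<open>The cyclic group \<open>C\<close> of order \<open>\<nu> = order C\<close> is written multiplicatively, as everywhere in
  HOL-Algebra, so its neutral element \<open>\<one>\<^bsub>C\<^esub>\<close> plays the role of \<open>0\<close>. The set \<open>[k - 1]\<close> is
  \<open>{1..k - 1}\<close>; truncated subtraction makes it empty for \<open>k \<le> 1\<close>.\<close>

definition Q :: "'a monoid \<Rightarrow> nat \<Rightarrow> (nat \<Rightarrow> 'a) monoid" where
  "Q C n = sum_group {1..n - 1} (\<lambda>_. C)"

text \<open>\<open>Q C n\<close> is abelian, so every complex function on it is a class function. Such a function is
  represented by a map \<open>(nat \<Rightarrow> 'a) \<Rightarrow> complex\<close>, of which only the values on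
  \<open>carrier (Q C n)\<close> are meaningful.\<close>

definition superclass :: "'a monoid \<Rightarrow> nat \<Rightarrow> nat set \<Rightarrow> (nat \<Rightarrow> 'a) set" where
  "superclass C n I = {g \<in> carrier (Q C n). \<forall>i\<in>{1..n - 1}. g i \<noteq> \<one>\<^bsub>C\<^esub> \<longleftrightarrow> i \<in> I}"

definition kappa :: "'a monoid \<Rightarrow> nat \<Rightarrow> nat set \<Rightarrow> (nat \<Rightarrow> 'a) \<Rightarrow> complex" where
  "kappa C n I = indicator (superclass C n I)"

definition rbar :: "'a monoid \<Rightarrow> 'a \<Rightarrow> complex" where
  "rbar C x = (if x = \<one>\<^bsub>C\<^esub> then 1 else - 1 / (of_nat (order C) - 1))"

definition endpoints :: "nat \<Rightarrow> nat set \<Rightarrow> nat set" where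
  "endpoints N A = {i \<in> {1..N - 1}. i \<in> A \<and> i + 1 \<notin> A}"

definition all_endpoints :: "nat \<Rightarrow> nat set \<Rightarrow> nat set" where
  "all_endpoints N A = endpoints N A \<union> endpoints N ({1..N} - A)"

text \<open>\<open>nth_elem A i\<close> is the \<open>i\<close>-th smallest element of the finite set \<open>A\<close>, counted from 1.\<close>

definition nth_elem :: "nat set \<Rightarrow> nat \<Rightarrow> nat" where
  "nth_elem A i = sorted_list_of_set A ! (i - 1)"

definition shuffle_set :: "nat \<Rightarrow> nat set \<Rightarrow> nat set \<Rightarrow> nat set \<Rightarrow> nat set" where
  "shuffle_set N A I J = nth_elem ({1..N} - A) ` I \<union> nth_elem A ` J"

definition s_fun ::
  "'a monoid \<Rightarrow> nat \<Rightarrow> nat \<Rightarrow> nat set \<Rightarrow> ((nat \<Rightarrow> 'a) \<Rightarrow> complex) \<Rightarrow> ((nat \<Rightarrow> 'a) \<Rightarrow> complex)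
    \<Rightarrow> (nat \<Rightarrow> 'a) \<Rightarrow> complex" where
  "s_fun C m n A \<phi> \<psi> h =
    (let a = nth_elem A; b = nth_elem ({1..m + n} - A)
     in \<phi> (\<lambda>i\<in>{1..m - 1}. h (b i)) * rbar C (h (b m)) *
        \<psi> (\<lambda>j\<in>{1..n - 1}. h (a j)) * rbar C (h (a n)))"

definition g_mod :: "'a monoid \<Rightarrow> nat \<Rightarrow> nat set \<Rightarrow> (nat \<Rightarrow> 'a) \<Rightarrow> nat \<Rightarrow> 'a" where
  "g_mod C N A g =
    (\<lambda>i\<in>{1..N}. if i \<in> {1..N - 1} - all_endpoints N A then g i else \<one>\<^bsub>C\<^esub>)"

text \<open>If \<open>m = 0\<close>, the function \<open>\<phi>\<close> on the one-element group \<open>Q C 0\<close> is identified with its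
  value at the neutral element, and the product is that scalar times \<open>\<psi>\<close>; similarly for
  \<open>n = 0\<close>.\<close>

definition m_A ::
  "'a monoid \<Rightarrow> nat \<Rightarrow> nat \<Rightarrow> nat set \<Rightarrow> ((nat \<Rightarrow> 'a) \<Rightarrow> complex) \<Rightarrow> ((nat \<Rightarrow> 'a) \<Rightarrow> complex)
    \<Rightarrow> (nat \<Rightarrow> 'a) \<Rightarrow> complex" where
  "m_A C m n A \<phi> \<psi> g =
    (if m = 0 then \<phi> \<one>\<^bsub>Q C 0\<^esub> * \<psi> g
     else if n = 0 then \<psi> \<one>\<^bsub>Q C 0\<^esub> * \<phi> g
     else (\<Prod>i\<in>endpoints (m + n) ({1..m + n} - A). rbar C (g i)) *
          s_fun C m n A \<phi> \<psi> (g_mod C (m + n) A g))"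

definition m_prod ::
  "'a monoid \<Rightarrow> nat \<Rightarrow> nat \<Rightarrow> ((nat \<Rightarrow> 'a) \<Rightarrow> complex) \<Rightarrow> ((nat \<Rightarrow> 'a) \<Rightarrow> complex)
    \<Rightarrow> (nat \<Rightarrow> 'a) \<Rightarrow> complex" where
  "m_prod C m n \<phi> \<psi> g = (\<Sum>A | A \<subseteq> {1..m + n} \<and> card A = n. m_A C m n A \<phi> \<psi> g)"

end

theory Submission
  imports Defs
begin

text \<open>Both sides are evaluated at a fixed \<open>g\<close> in \<open>Q C (m + n)\<close>. The superclasses partition the group, so
  on the right only the summand \<open>d K\<close> survives, where \<open>K\<close> is the set of positions at which \<open>g\<close> is
  nontrivial. It remains to compare the contributions of a single \<open>A\<close>.

  Suppose \<open>m\<close> and \<open>n\<close> are positive. On the left, let \<open>e\<close> be the set of all endpoints of \<open>A\<close> and of its complement. The product over the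
  endpoints of the complement gives one factor \<open>1 / (1 - \<nu>)\<close> for each such endpoint in \<open>K\<close>. Passing to
  \<open>g_mod\<close> erases the entries in \<open>e\<close> and puts a trivial entry at \<open>m + n\<close>, so what remains is nontrivial
  exactly on \<open>K - e\<close>. The largest element of \<open>A\<close>, and likewise of its complement, is either \<open>m + n\<close>
  or an endpoint; the two factors \<open>rbar\<close> in \<open>s_fun\<close> are therefore evaluated at trivial entries
  and equal 1. The remaining two factors are the indicators of the pulled back support being \<open>I\<close> along
  the complement and \<open>J\<close> along \<open>A\<close>. As all elements of \<open>K - e\<close> lie at the positions that these two pullbacks
  see, both hold exactly when \<open>K - e\<close> is the shuffled set \<open>S\<close> of \<open>I\<close> and \<open>J\<close> along \<open>A\<close>
  (\<open>eq_shuffle_image_iff\<close>). This is the content of \<open>m_A_kappa\<close>, and it matches the right-hand side because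
  \<open>K - e = S\<close> is a restatement of the three conditions on \<open>A\<close> in the definition of \<open>d\<close>.\<close>

section \<open>Superclass functions at a group element\<close>

definition nontriv :: "'a monoid \<Rightarrow> nat \<Rightarrow> (nat \<Rightarrow> 'a) \<Rightarrow> nat set" where
  "nontriv C n g = {i \<in> {1..n - 1}. g i \<noteq> \<one>\<^bsub>C\<^esub>}"

lemma carrier_Q:
  assumes "group C"
  shows "carrier (Q C n) = ({1..n - 1} \<rightarrow>\<^sub>E carrier C)"
  using assms by (auto simp: Q_def carrier_sum_group)

lemma kappa_eq_of_bool:
  assumes "g \<in> carrier (Q C n)" "I \<subseteq> {1..n - 1}"
  shows "kappa C n I g = of_bool (nontriv C n g = I)"
  using assms by (auto simp: kappa_def superclass_def nontriv_def indicator_def of_bool_def)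

lemma kappa_restrict:
  assumes "group C" "I \<subseteq> {1..n - 1}" "\<And>i. i \<in> {1..n - 1} \<Longrightarrow> h i \<in> carrier C"
  shows "kappa C n I (restrict h {1..n - 1}) = of_bool (nontriv C n h = I)"
proof -
  have "restrict h {1..n - 1} \<in> carrier (Q C n)"
    using assms by (auto simp: carrier_Q)
  moreover have "nontriv C n (restrict h {1..n - 1}) = nontriv C n h"
    by (auto simp: nontriv_def)
  ultimately show ?thesis
    using assms by (simp add: kappa_eq_of_bool)
qed

text \<open>Every group element lies in exactly one superclass, so evaluating a superclass function at \<open>g\<close> reads
  off one coefficient.\<close>

lemma sum_kappa:
  assumes "g \<in> carrier (Q C n)"
  shows "(\<Sum>K \<in> Pow {1..n - 1}. d K * kappa C n K g) = d (nontriv C n g)"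
proof -
  have "(\<Sum>K \<in> Pow {1..n - 1}. d K * kappa C n K g)
      = (\<Sum>K \<in> Pow {1..n - 1}. if nontriv C n g = K then d K else 0)"
    using assms by (intro sum.cong) (auto simp: kappa_eq_of_bool)
  also have "\<dots> = d (nontriv C n g)"
    by (subst sum.delta') (auto simp: nontriv_def)
  finally show ?thesis .
qed

text \<open>The function \<open>rbar\<close> is 1 at the neutral element and constant elsewhere, so the product only depends on
  the number of nontrivial entries.\<close>

lemma prod_rbar:
  assumes "order C > 1" "E \<subseteq> {1..n - 1}"
  shows "(\<Prod>i\<in>E. rbar C (g i)) = (1 / (1 - of_nat (order C))) ^ card (nontriv C n g \<inter> E)"
proof -
  have fin: "finite E"
    using assms finite_subset by blast
  have "of_nat (order C) \<noteq> (1 :: complex)"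
    using assms by simp
  then have r: "- 1 / (of_nat (order C) - 1) = (1 / (1 - of_nat (order C)) :: complex)"
    by (simp add: field_simps)
  have "(\<Prod>i\<in>E. rbar C (g i))
      = (\<Prod>i\<in>E. if i \<in> nontriv C n g \<inter> E then 1 / (1 - of_nat (order C)) else 1)"
    using assms r by (intro prod.cong) (auto simp: rbar_def nontriv_def)
  also have "\<dots> = (\<Prod>i\<in>nontriv C n g \<inter> E. 1 / (1 - of_nat (order C)))"
    using fin by (intro prod.mono_neutral_cong_right) auto
  finally show ?thesis by simp
qed

section \<open>Enumerations and endpoints of subsets\<close>

lemma bij_betw_nth_elem:
  assumes "finite A"
  shows "bij_betw (nth_elem A) {1..card A} A"
proof -
  have "bij_betw ((!) (sorted_list_of_set A)) {..<card A} A"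
    using assms by (intro bij_betw_nth) auto
  moreover have "bij_betw (\<lambda>i. i - 1) {1..card A} {..<card A}"
    by (rule bij_betw_byWitness[where f' = Suc]) auto
  ultimately have "bij_betw ((!) (sorted_list_of_set A) \<circ> (\<lambda>i. i - 1)) {1..card A} A"
    using bij_betw_trans by blast
  then show ?thesis
    by (simp add: nth_elem_def[abs_def] comp_def)
qed

lemma nth_elem_card:
  assumes "finite A" "A \<noteq> {}"
  shows "nth_elem A (card A) = Max A"
proof -
  let ?xs = "sorted_list_of_set A"
  have xs: "?xs \<noteq> []" "set ?xs = A"
    using assms by simp_all
  have "x \<le> last ?xs" if "x \<in> set (butlast ?xs @ [last ?xs])" for x
  proof -
    have "sorted (butlast ?xs @ [last ?xs])"
      using xs(1) by simp
    then show ?thesis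
      using that unfolding sorted_append by auto
  qed
  then have "last ?xs = Max A"
    using xs assms(1) last_in_set[of ?xs] by (intro Max_eqI[symmetric]) simp_all
  then show ?thesis
    using assms by (simp add: nth_elem_def last_conv_nth)
qed

lemma nth_elem_interval:
  assumes "i \<in> {1..n}"
  shows "nth_elem {1..n} i = i"
proof -
  have "sorted_list_of_set {1..n} = [1..<Suc n]"
    by (simp add: sorted_list_of_set_range flip: atLeastLessThanSuc_atLeastAtMost del: upt_Suc)
  then show ?thesis
    using assms by (auto simp: nth_elem_def simp del: upt_Suc)
qed

text \<open>The successor of the maximum is outside \<open>A\<close>, so only the bound \<open>N - 1\<close> can prevent the maximum from being
  an endpoint. This makes both factors \<open>rbar\<close> in \<open>s_fun\<close> trivial.\<close>

lemma Max_endpoints: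
  assumes "A \<subseteq> {1..N}" "A \<noteq> {}"
  shows "Max A = N \<or> Max A \<in> endpoints N A"
proof -
  have "finite A" using assms finite_subset by blast
  then have max: "Max A \<in> A"
    using assms(2) Max_in by blast
  have "Max A + 1 \<notin> A"
  proof
    assume "Max A + 1 \<in> A"
    then have "Max A + 1 \<le> Max A"
      by (rule Max_ge[OF \<open>finite A\<close>])
    then show False by simp
  qed
  moreover have "Max A \<in> {1..N}"
    using assms(1) max by blast
  ultimately show ?thesis
    using max by (auto simp: endpoints_def)
qed

text \<open>A subset of a disjoint union of two parametrized sets is determined by its two pullbacks. It is used with
  the enumerations of the complement and of \<open>A\<close>, each without its last element.\<close>

lemma eq_shuffle_image_iff:
  assumes "inj_on b M" "inj_on a L" "b ` M \<inter> a ` L = {}"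
    and "I \<subseteq> M" "J \<subseteq> L" "T \<subseteq> b ` M \<union> a ` L"
  shows "T = b ` I \<union> a ` J \<longleftrightarrow> {i \<in> M. b i \<in> T} = I \<and> {j \<in> L. a j \<in> T} = J"
  (is "?l \<longleftrightarrow> ?r")
proof
  assume ?l
  have "b i \<in> T \<longleftrightarrow> i \<in> I" if "i \<in> M" for i
    using that assms inj_on_image_mem_iff[OF assms(1) that assms(4)] unfolding \<open>?l\<close> by blast
  moreover have "a j \<in> T \<longleftrightarrow> j \<in> J" if "j \<in> L" for j
    using that assms inj_on_image_mem_iff[OF assms(2) that assms(5)] unfolding \<open>?l\<close> by blast
  ultimately show ?r using assms(4,5) by blast
next
  assume ?r
  then show ?l using assms(6) by blast
qed

text \<open>The left-hand side is the shape of the conditions on \<open>A\<close> in the definition of \<open>d K\<close>; the right-hand side is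
  how the same condition appears after \<open>g_mod\<close> has erased the entries at endpoints.\<close>

lemma between_disjoint_iff_Diff_eq:
  "S \<inter> E = {} \<and> S \<subseteq> K \<and> K \<subseteq> S \<union> E \<longleftrightarrow> K - E = S"
  by blast

text \<open>The functions \<open>\<phi>\<close> and \<open>\<psi>\<close> see all positions of a block except the last one, and the last one
  carries no information because \<open>g_mod\<close> is trivial both at \<open>N\<close> and at endpoints.\<close>

lemma nth_elem_nonlast:
  assumes "A \<subseteq> {1..N}" "card A = n" "n > 0"
  shows "inj_on (nth_elem A) {1..n - 1}" "nth_elem A ` {1..n - 1} = A - {nth_elem A n}"
    and "nth_elem A n = N \<or> nth_elem A n \<in> endpoints N A" "nth_elem A n \<in> A"
proof -
  have fin: "finite A" "A \<noteq> {}" using assms finite_subset by fastforce+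
  have bij: "bij_betw (nth_elem A) {1..n} A"
    using bij_betw_nth_elem fin assms by blast
  have n: "{1..n - 1} = {1..n} - {n}" using assms by auto
  show "inj_on (nth_elem A) {1..n - 1}"
    using bij unfolding n bij_betw_def by (blast intro: inj_on_diff)
  show "nth_elem A ` {1..n - 1} = A - {nth_elem A n}"
    using bij assms(3) unfolding n bij_betw_def
    by (subst inj_on_image_set_diff[of _ "{1..n}"]) auto
  show "nth_elem A n = N \<or> nth_elem A n \<in> endpoints N A"
    using Max_endpoints[of A N] nth_elem_card[of A] fin assms by simp
  show "nth_elem A n \<in> A" using nth_elem_card[of A] fin assms by simp
qed

section \<open>The product of superclass identifiers\<close>

text \<open>The comparison for a single \<open>A\<close>. If one of the factors has degree 0, then \<open>A\<close> or its complement is empty,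
  there are no endpoints, and the shuffle is the identity; so the formula also covers the scalar products by
  which \<open>m_A\<close> is defined in these cases.\<close>

lemma m_A_kappa:
  fixes C :: "'a monoid"
  assumes C: "group C" "order C > 1"
    and IJ: "I \<subseteq> {1..m - 1}" "J \<subseteq> {1..n - 1}"
    and A: "A \<subseteq> {1..m + n}" "card A = n"
    and g: "g \<in> carrier (Q C (m + n))"
  defines "K \<equiv> nontriv C (m + n) g"
  shows "m_A C m n A (kappa C m I) (kappa C n J) g =
    (if K - all_endpoints (m + n) A = shuffle_set (m + n) A I J
     then (1 / (1 - of_nat (order C))) ^ card (K \<inter> endpoints (m + n) ({1..m + n} - A))
     else 0)"
proof -
  have unit: "kappa C 0 {} \<one>\<^bsub>Q C 0\<^esub> = 1"
    by (simp add: kappa_def superclass_def Q_def carrier_sum_group C restrict_def)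
  have ends_trivial: "endpoints N {1..N} = {}" "endpoints N {} = {}" for N
    by (auto simp: endpoints_def)
  have nth_image: "nth_elem {1..N} ` S = S" if "S \<subseteq> {1..N - 1}" for N S
  proof -
    have "S \<subseteq> {1..N}"
      using that by force
    then have "nth_elem {1..N} ` S = id ` S"
      using nth_elem_interval by (intro image_cong) (auto simp del: atLeastAtMost_iff)
    then show ?thesis by simp
  qed
  define N where "N = m + n"
  define B where "B = {1..N} - A"
  have finA: "finite A" using A finite_subset by blast
  have cardB: "card B = m" unfolding B_def N_def using A finA by (simp add: card_Diff_subset)
  consider "m = 0" | "m > 0" "n = 0" | "m > 0" "n > 0" by blast
  then show ?thesis
  proof cases
    case 1
    then have "A = {1..n}" "I = {}"
      using A IJ card_subset_eq[of "{1..n}" A] by auto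
    then show ?thesis
      using 1 g IJ unit ends_trivial kappa_eq_of_bool[of g C n J] nth_image[OF IJ(2)]
      by (simp add: m_A_def all_endpoints_def shuffle_set_def K_def)
  next
    case 2
    then have "A = {}" "J = {}"
      using A IJ finA by auto
    then show ?thesis
      using 2 g IJ unit ends_trivial kappa_eq_of_bool[of g C m I] nth_image[OF IJ(1)]
      by (simp add: m_A_def all_endpoints_def shuffle_set_def K_def)
  next
    case 3
    define E where "E = all_endpoints N A"
    define h where "h = g_mod C N A g"
    define a b where "a = nth_elem A" and "b = nth_elem B"
    have AB: "A \<subseteq> {1..N}" "B \<subseteq> {1..N}" "A \<inter> B = {}" "A \<union> B = {1..N}"
      using A by (auto simp: B_def N_def)
    note a = nth_elem_nonlast[OF AB(1) A(2) 3(2), folded a_def]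
    note b = nth_elem_nonlast[OF AB(2) cardB 3(1), folded b_def]
    have E: "E = endpoints N A \<union> endpoints N B"
      by (simp add: E_def all_endpoints_def B_def N_def)
    have h_carrier: "h i \<in> carrier C" if "i \<in> {1..N}" for i
      using that g C by (auto simp: h_def g_mod_def carrier_Q N_def group.is_monoid)
    have h_nontriv: "h i \<noteq> \<one>\<^bsub>C\<^esub> \<longleftrightarrow> i \<in> K - E" if "i \<in> {1..N}" for i
      using that by (auto simp: h_def g_mod_def K_def E_def nontriv_def N_def)
    \<comment> \<open>The last position of each block is \<open>N\<close>, which is outside \<open>K\<close>, or an endpoint, which is in \<open>E\<close>.\<close>
    have "N \<notin> K"
      using 3 by (auto simp: K_def nontriv_def N_def)
    then have last_notin: "a n \<notin> K - E" "b m \<notin> K - E"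
      using a(3) b(3) E by auto
    have "a n \<in> {1..N}" "b m \<in> {1..N}"
      using a(4) b(4) AB by blast+
    then have last_trivial: "h (a n) = \<one>\<^bsub>C\<^esub>" "h (b m) = \<one>\<^bsub>C\<^esub>"
      using h_nontriv last_notin by blast+
    have range: "a j \<in> {1..N}" if "j \<in> {1..n - 1}" for j
      using that a(2) AB(1) by blast
    have range': "b i \<in> {1..N}" if "i \<in> {1..m - 1}" for i
      using that b(2) AB(2) by blast
    have "nontriv C n (\<lambda>j. h (a j)) = {j \<in> {1..n - 1}. a j \<in> K - E}"
      unfolding nontriv_def using h_nontriv range by blast
    then have J: "kappa C n J (\<lambda>j\<in>{1..n - 1}. h (a j)) = of_bool ({j \<in> {1..n - 1}. a j \<in> K - E} = J)"
      using kappa_restrict[of C J n "\<lambda>j. h (a j)"] C IJ h_carrier range by simp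
    have "nontriv C m (\<lambda>i. h (b i)) = {i \<in> {1..m - 1}. b i \<in> K - E}"
      unfolding nontriv_def using h_nontriv range' by blast
    then have I: "kappa C m I (\<lambda>i\<in>{1..m - 1}. h (b i)) = of_bool ({i \<in> {1..m - 1}. b i \<in> K - E} = I)"
      using kappa_restrict[of C I m "\<lambda>i. h (b i)"] C IJ h_carrier range' by simp
    have "K \<subseteq> A \<union> B" unfolding AB(4) by (auto simp: K_def nontriv_def N_def)
    then have "K - E \<subseteq> b ` {1..m - 1} \<union> a ` {1..n - 1}"
      using last_notin unfolding a(2) b(2) by blast
    moreover have "b ` {1..m - 1} \<inter> a ` {1..n - 1} = {}"
      using AB(3) unfolding a(2) b(2) by blast
    ultimately have "K - E = b ` I \<union> a ` J \<longleftrightarrow>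
        {i \<in> {1..m - 1}. b i \<in> K - E} = I \<and> {j \<in> {1..n - 1}. a j \<in> K - E} = J"
      using a(1) b(1) IJ by (intro eq_shuffle_image_iff)
    then have "s_fun C m n A (kappa C m I) (kappa C n J) h = of_bool (K - E = shuffle_set N A I J)"
      using last_trivial I J
      by (simp add: s_fun_def Let_def shuffle_set_def rbar_def a_def b_def B_def N_def)
    moreover have "(\<Prod>i\<in>endpoints N B. rbar C (g i))
        = (1 / (1 - of_nat (order C))) ^ card (K \<inter> endpoints N B)"
      unfolding K_def N_def by (intro prod_rbar C) (auto simp: endpoints_def)
    ultimately show ?thesis
      using 3 by (simp add: m_A_def E_def h_def B_def N_def)
  qed
qed

theorem proposition3p15:
  fixes C :: "'a monoid" and \<nu> m n :: nat and I J :: "nat set"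
  assumes "group C" and "cyclic_group C" and "order C = \<nu>" and "\<nu> > 1"
    and "I \<subseteq> {1..m - 1}" and "J \<subseteq> {1..n - 1}"
  defines "d \<equiv> \<lambda>K. \<Sum>A | A \<subseteq> {1..m + n} \<and> card A = n
      \<and> shuffle_set (m + n) A I J \<inter> all_endpoints (m + n) A = {}
      \<and> shuffle_set (m + n) A I J \<subseteq> K
      \<and> K \<subseteq> shuffle_set (m + n) A I J \<union> all_endpoints (m + n) A.
    (1 / (1 - of_nat \<nu> :: complex)) ^ card (K \<inter> endpoints (m + n) ({1..m + n} - A))"
  shows "\<forall>g \<in> carrier (Q C (m + n)).
    m_prod C m n (kappa C m I) (kappa C n J) g =
      (\<Sum>K \<in> Pow {1..m + n - 1}. d K * kappa C (m + n) K g)"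
proof
  fix g assume g: "g \<in> carrier (Q C (m + n))"
  let ?N = "m + n"
  let ?K = "nontriv C ?N g"
  let ?S = "\<lambda>A. shuffle_set ?N A I J"
  let ?E = "all_endpoints ?N"
  let ?t = "\<lambda>A. (1 / (1 - of_nat \<nu> :: complex)) ^ card (?K \<inter> endpoints ?N ({1..?N} - A))"
  have fin: "finite {A. A \<subseteq> {1..?N} \<and> card A = n}" by simp
  have "m_prod C m n (kappa C m I) (kappa C n J) g
      = (\<Sum>A | A \<subseteq> {1..?N} \<and> card A = n. if ?K - ?E A = ?S A then ?t A else 0)"
    unfolding m_prod_def using assms g by (intro sum.cong refl) (auto simp: m_A_kappa)
  also have "\<dots> = (\<Sum>A | A \<subseteq> {1..?N} \<and> card A = n \<and> ?K - ?E A = ?S A. ?t A)"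
    by (subst sum.inter_filter[OF fin, symmetric]) (simp add: conj_assoc)
  also have "\<dots> = d ?K"
    unfolding d_def between_disjoint_iff_Diff_eq ..
  also have "\<dots> = (\<Sum>K \<in> Pow {1..?N - 1}. d K * kappa C ?N K g)"
    using sum_kappa[OF g, of d] by simp
  finally show "m_prod C m n (kappa C m I) (kappa C n J) g
      = (\<Sum>K \<in> Pow {1..?N - 1}. d K * kappa C ?N K g)" .
qed

end
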